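(* Let $\mathcal{A}$ be a class of positive continuous probability densities on $\mathbf{R}$ for which there is a point $x_*\in\mathbf{R}$ such that $g_1(x_* )\neq g_2(x_* )$ for each different $g_1,g_2\in\mathcal{A}$. Put $\Theta=\{g(x_* ):g\in\mathcal{A}\}$ and, for $\theta\in\Theta$, let $f_\theta$ be the unique element $f$ of $\mathcal{A}$ with $f(x_* )=\theta$; let $\mu_\theta$ be the Borel probability measure on $\mathbf{R}$ with probability density function $f_\theta$. Let $(h_m)_{m\in\mathbb{N}}$ be a strictly decreasing sequence of positive numbers tending to zero. Fix $\theta_0\in\Theta$. For each $(x_k)_{k\in\mathbb{N}}\in\mathbf{R}^{\mathbb{N}}$ put $$T((x_k)_{k\in\mathbb{N}})=\lim_{m\to\infty}\lim_{n\to\infty}\frac{\#(\{x_1,\dots,x_n\}\cap[x_*-h_m,x_*+h_m])}{2nh_m}$$ if this repeated limit exists and belongs to the set $\Theta\setminus\{\theta_0\}$, and $T((x_k)_{k\in\mathbb{N}})=\theta_0$ otherwise. Then $T$ is an infinite sample consistent estimate of the parameter $\theta$ for the family $(\mu_\theta^{\mathbb{N}})_{\theta\in\Theta}$.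
   Context: $\#$ denotes counting measure; $\mu^{\mathbb{N}}=\mu\times\mu\times\cdots$ is the infinite power of $\mu$ on $\mathbf{R}^{\mathbb{N}}$, and $\mathcal{B}(\mathbf{R}^{\mathbb{N}})$ is the Borel $\sigma$-algebra of $\mathbf{R}^{\mathbb{N}}$ (product topology). Let $L(\Theta)$ be the minimal $\sigma$-algebra of subsets of $\Theta$ generated by all singletons. A $(\mathcal{B}(\mathbf{R}^{\mathbb{N}}),L(\Theta))$-measurable function $T:\mathbf{R}^{\mathbb{N}}\to\Theta$ is an infinite sample consistent estimate of $\theta$ for $(\mu_\theta^{\mathbb{N}})_{\theta\in\Theta}$ if $\mu_\theta^{\mathbb{N}}(\{(x_k)_{k\in\mathbb{N}}:T((x_k)_{k\in\mathbb{N}})=\theta\})=1$ for each $\theta\in\Theta$.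
   Formalization: If Θ is not a Borel set, T fails to be (B(R^N), L(Θ))-measurable, so full consistency is stated for Borel Θ only; for arbitrary Θ it is stated that T = θ holds almost surely with respect to μ_θ^N for every θ in Θ. *)

theory Defs
  imports "HOL-Probability.Probability"
begin

definition pos_cont_density :: "(real \<Rightarrow> real) \<Rightarrow> bool" where
  "pos_cont_density g \<longleftrightarrow>
     (\<forall>x. 0 < g x) \<and> continuous_on UNIV g \<and> (\<integral>\<^sup>+ x. ennreal (g x) \<partial>lborel) = 1"

definition param_set :: "(real \<Rightarrow> real) set \<Rightarrow> real \<Rightarrow> real set" where
  "param_set \<A> xs = {g xs | g. g \<in> \<A>}"

definition param_density :: "(real \<Rightarrow> real) set \<Rightarrow> real \<Rightarrow> real \<Rightarrow> real \<Rightarrow> real" where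
  "param_density \<A> xs \<theta> = (THE f. f \<in> \<A> \<and> f xs = \<theta>)"

definition param_measure :: "(real \<Rightarrow> real) set \<Rightarrow> real \<Rightarrow> real \<Rightarrow> real measure" where
  "param_measure \<A> xs \<theta> = density lborel (\<lambda>x. ennreal (param_density \<A> xs \<theta> x))"

definition infinite_power :: "real measure \<Rightarrow> (nat \<Rightarrow> real) measure" where
  "infinite_power \<mu> = Pi\<^sub>M UNIV (\<lambda>_. \<mu>)"

definition singleton_algebra :: "'t set \<Rightarrow> 't measure" where
  "singleton_algebra \<Theta> = sigma \<Theta> {{\<theta>} | \<theta>. \<theta> \<in> \<Theta>}"

text \<open>Below, \<open>borel\<close> is the Borel \<open>\<sigma>\<close>-algebra of the product topology on \<open>nat \<Rightarrow> real\<close>.\<close>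

definition infinite_sample_consistent_estimate ::
    "'t set \<Rightarrow> ('t \<Rightarrow> real measure) \<Rightarrow> ((nat \<Rightarrow> real) \<Rightarrow> 't) \<Rightarrow> bool" where
  "infinite_sample_consistent_estimate \<Theta> \<mu> T \<longleftrightarrow>
     T \<in> measurable borel (singleton_algebra \<Theta>) \<and>
     (\<forall>\<theta>\<in>\<Theta>. emeasure (infinite_power (\<mu> \<theta>)) {x. T x = \<theta>} = 1)"

text \<open>Sequences are indexed from 0, so \<open>x ` {..<n}\<close> is the set of the first \<open>n\<close> sample values.
  As a set, it counts repeated values once.\<close>

definition window_ratio :: "real \<Rightarrow> (nat \<Rightarrow> real) \<Rightarrow> (nat \<Rightarrow> real) \<Rightarrow> nat \<Rightarrow> nat \<Rightarrow> real" where
  "window_ratio xs h x m n =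
     real (card (x ` {..<n} \<inter> {xs - h m .. xs + h m})) / (2 * real n * h m)"

definition repeated_limit_exists :: "(nat \<Rightarrow> nat \<Rightarrow> real) \<Rightarrow> bool" where
  "repeated_limit_exists a \<longleftrightarrow>
     (\<forall>m. convergent (a m)) \<and> convergent (\<lambda>m. lim (a m))"

definition repeated_limit :: "(nat \<Rightarrow> nat \<Rightarrow> real) \<Rightarrow> real" where
  "repeated_limit a = lim (\<lambda>m. lim (a m))"

definition T_est ::
    "(real \<Rightarrow> real) set \<Rightarrow> real \<Rightarrow> (nat \<Rightarrow> real) \<Rightarrow> real \<Rightarrow> (nat \<Rightarrow> real) \<Rightarrow> real" where
  "T_est \<A> xs h \<theta>0 x =
     (if repeated_limit_exists (window_ratio xs h x) \<and>
         repeated_limit (window_ratio xs h x) \<in> param_set \<A> xs - {\<theta>0}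
      then repeated_limit (window_ratio xs h x) else \<theta>0)"

end

theory Submission
  imports Defs
begin

text \<open>
  Fix \<open>\<theta>\<close>, let \<open>f\<close> be the density with \<open>f xs = \<theta>\<close>, and let the sample be drawn from the infinite
  power of the measure \<open>\<mu>\<close> with density \<open>f\<close>. Since \<open>\<mu>\<close> has no atoms, the sample values are almost
  surely pairwise distinct (\<open>AE_inj_sample\<close>), so the number of distinct sample values in a window
  is the number of sample indices that hit it, and the inner limit is a limit of relative
  frequencies. By the strong law of large numbers it equals \<open>\<mu> W / (2 * h m)\<close> for the window
  \<open>W = {xs - h m..xs + h m}\<close>, almost surely for all of the countably many \<open>m\<close> at once. For
  indicator variables the strong law follows from Hoeffding's inequality, whose exponentially
  small tails are summable, and the Borel-Cantelli lemma (\<open>relative_frequency_tendsto_AE\<close>). The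
  outer limit is then the limit of the averages of \<open>f\<close> over shrinking windows, which is \<open>f xs\<close>
  by continuity (\<open>window_average_tendsto\<close>). Hence the repeated limit is almost surely \<open>\<theta>\<close>. If
  \<open>\<theta> = \<theta>0\<close>, this limit is not in \<open>\<Theta> - {\<theta>0}\<close>, and the default value of the estimate is the
  correct one.

  For a Borel set \<open>\<Theta>\<close> the estimate is a Borel function, because the window count is a finite sum of indicators of Borel sets
  (\<open>card_image_Int_eq_sum_first_occurrences\<close>) and countable limits of measurable functions, as
  well as the sets where they exist, are measurable. The probability of \<open>{x. T x = \<theta>}\<close> is then
  determined by the almost sure statement.
\<close>

section \<open>Coordinates of an infinite power\<close>

lemma indep_vars_coordinates:
  assumes "prob_space \<mu>"
  shows "prob_space.indep_vars (Pi\<^sub>M UNIV (\<lambda>_. \<mu>)) (\<lambda>_. \<mu>) (\<lambda>i x. x i) (UNIV :: 'i set)"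
proof -
  interpret P: prob_space "Pi\<^sub>M (UNIV :: 'i set) (\<lambda>_. \<mu>)"
    by (intro prob_space_PiM assms)
  have "(\<lambda>x :: 'i \<Rightarrow> 'a. \<lambda>i\<in>UNIV. x i) = (\<lambda>x. x)"
    by (simp add: fun_eq_iff)
  then show ?thesis
    by (subst P.indep_vars_iff_distr_eq_PiM')
       (simp_all add: distr_id2 distr_PiM_component[where M = "\<lambda>_. \<mu>"] assms)
qed

text \<open>Two distinct coordinates are independent, so their joint law is the product measure, where
  an almost sure statement can be checked one variable at a time.\<close>

lemma AE_coordinate_pair:
  fixes i j :: 'i
  assumes "prob_space \<mu>" and "i \<noteq> j"
    and meas: "{z \<in> space (\<mu> \<Otimes>\<^sub>M \<mu>). P (fst z) (snd z)} \<in> sets (\<mu> \<Otimes>\<^sub>M \<mu>)"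
    and ae: "AE s in \<mu>. AE t in \<mu>. P s t"
  shows "AE x in Pi\<^sub>M (UNIV :: 'i set) (\<lambda>_. \<mu>). P (x i) (x j)"
proof -
  interpret P: prob_space "Pi\<^sub>M (UNIV :: 'i set) (\<lambda>_. \<mu>)"
    by (intro prob_space_PiM assms)
  interpret M: prob_space \<mu> by fact
  interpret MM: pair_prob_space \<mu> \<mu> ..
  have "P.indep_var (Pi\<^sub>M {i} (\<lambda>_. \<mu>)) (\<lambda>x. \<lambda>k\<in>{i}. x k) (Pi\<^sub>M {j} (\<lambda>_. \<mu>)) (\<lambda>x. \<lambda>k\<in>{j}. x k)"
    by (rule P.indep_var_restrict[OF indep_vars_coordinates[OF \<open>prob_space \<mu>\<close>]])
       (use \<open>i \<noteq> j\<close> in auto)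
  from P.indep_var_compose[OF this, of "\<lambda>y. y i" \<mu> "\<lambda>y. y j" \<mu>]
  have "P.indep_var \<mu> (\<lambda>x. x i) \<mu> (\<lambda>x. x j)"
    by (simp add: o_def)
  then have *: "distr (Pi\<^sub>M (UNIV :: 'i set) (\<lambda>_. \<mu>)) (\<mu> \<Otimes>\<^sub>M \<mu>) (\<lambda>x. (x i, x j)) = \<mu> \<Otimes>\<^sub>M \<mu>"
    by (simp add: P.indep_var_distribution_eq distr_PiM_component[where M = "\<lambda>_. \<mu>"] assms)
  have "AE z in \<mu> \<Otimes>\<^sub>M \<mu>. P (fst z) (snd z)"
    using meas ae by (intro MM.AE_pair_measure) auto
  then have "AE z in distr (Pi\<^sub>M (UNIV :: 'i set) (\<lambda>_. \<mu>)) (\<mu> \<Otimes>\<^sub>M \<mu>) (\<lambda>x. (x i, x j)). P (fst z) (snd z)"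
    unfolding * .
  then show ?thesis
    by (subst (asm) AE_distr_iff) (use meas in auto)
qed

text \<open>Without atoms, for fixed \<open>i \<noteq> j\<close> the value \<open>x j\<close> almost surely avoids any given value of \<open>x i\<close>, and
  there are only countably many pairs of indices.\<close>

lemma AE_inj_sample:
  fixes \<mu> :: "real measure"
  assumes "prob_space \<mu>" and sets: "sets \<mu> = sets borel"
    and no_atoms: "\<And>a. AE t in \<mu>. t \<noteq> a"
  shows "AE x in Pi\<^sub>M (UNIV :: nat set) (\<lambda>_. \<mu>). inj x"
proof -
  have meas: "{z \<in> space (\<mu> \<Otimes>\<^sub>M \<mu>). fst z \<noteq> snd z} \<in> sets (\<mu> \<Otimes>\<^sub>M \<mu>)"
  proof -
    have [measurable_cong]: "sets \<mu> = sets borel" by (rule sets)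
    show ?thesis by measurable
  qed
  have "AE x in Pi\<^sub>M (UNIV :: nat set) (\<lambda>_. \<mu>). i \<noteq> j \<longrightarrow> x i \<noteq> x j" for i j
  proof (cases "i = j")
    case False
    have "AE s in \<mu>. AE t in \<mu>. s \<noteq> t"
    proof (rule AE_I2)
      show "AE t in \<mu>. s \<noteq> t" for s
        using no_atoms[of s] by eventually_elim auto
    qed
    from AE_coordinate_pair[OF \<open>prob_space \<mu>\<close> False meas this] show ?thesis by simp
  qed simp
  then have "AE x in Pi\<^sub>M (UNIV :: nat set) (\<lambda>_. \<mu>). \<forall>i j. i \<noteq> j \<longrightarrow> x i \<noteq> x j"
    by (simp add: AE_all_countable)
  then show ?thesis
    by eventually_elim (auto simp: inj_def)
qed

section \<open>The strong law for relative frequencies\<close>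

text \<open>The indicators of \<open>x i \<in> S\<close> are independent and bounded, so Hoeffding's inequality bounds the
  probability of a deviation by at least \<open>\<epsilon>\<close> by a geometric sequence in \<open>n\<close>. By Borel-Cantelli
  almost surely only finitely many such deviations occur; the bounds \<open>\<epsilon> = 1 / Suc k\<close> together
  give convergence.\<close>

lemma relative_frequency_tendsto_AE:
  assumes "prob_space \<mu>" and S [measurable]: "S \<in> sets \<mu>"
  shows "AE x in Pi\<^sub>M (UNIV :: nat set) (\<lambda>_. \<mu>).
           (\<lambda>n. (\<Sum>i<n. indicat_real S (x i)) / real n) \<longlonglongrightarrow> measure \<mu> S"
proof -
  interpret M: prob_space \<mu> by fact
  define P where "P = Pi\<^sub>M (UNIV :: nat set) (\<lambda>_. \<mu>)"
  interpret P: prob_space P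
    unfolding P_def by (intro prob_space_PiM assms)
  have indep: "P.indep_vars (\<lambda>_. \<mu>) (\<lambda>i x. x i) UNIV"
    unfolding P_def by (rule indep_vars_coordinates[OF \<open>prob_space \<mu>\<close>])
  have [measurable]: "(\<lambda>x. x i) \<in> measurable P \<mu>" for i
    unfolding P_def by measurable
  have coord: "distr P \<mu> (\<lambda>x. x i) = \<mu>" for i
    unfolding P_def by (simp add: distr_PiM_component[where M = "\<lambda>_. \<mu>"] assms)
  define avg :: "(nat \<Rightarrow> 'a) \<Rightarrow> nat \<Rightarrow> real"
    where "avg x n = (\<Sum>i<n. indicator S (x i)) / real n" for x n
  have [measurable]: "(\<lambda>x. avg x n) \<in> borel_measurable P" for n
    unfolding avg_def by measurable
  have tail: "P.prob {x \<in> space P. \<epsilon> \<le> \<bar>avg x n - measure \<mu> S\<bar>} \<le> 2 * exp (- 2 * \<epsilon>\<^sup>2) ^ n"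
    if "0 < \<epsilon>" "0 < n" for \<epsilon> n
  proof -
    interpret H: Hoeffding_ineq_iid P "{..<n}" "\<lambda>i x. indicat_real S (x i)"
        "\<lambda>x. indicat_real S (x 0)" 0 1 "measure \<mu> S"
    proof unfold_locales
      show "P.indep_vars (\<lambda>_. borel) (\<lambda>i x. indicat_real S (x i)) {..<n}"
        by (rule P.indep_vars_compose2[OF P.indep_vars_subset[OF indep]]) auto
      have *: "distr P borel (\<lambda>x. indicat_real S (x i)) = distr \<mu> borel (indicator S)" for i
        by (subst coord[of i, symmetric], subst distr_distr) (auto simp: o_def)
      show "distr P borel (\<lambda>x. indicat_real S (x i)) = distr P borel (\<lambda>x. indicator S (x 0))" for i
        by (simp only: *)
      have "P.expectation (\<lambda>x. indicat_real S (x 0)) = integral\<^sup>L (distr P \<mu> (\<lambda>x. x 0)) (indicator S)"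
        by (subst integral_distr) auto
      also have "\<dots> = measure \<mu> S"
        using sets.sets_into_space[OF S] by (simp add: coord Int_absorb2)
      finally show "measure \<mu> S \<equiv> P.expectation (\<lambda>x. indicat_real S (x 0))"
        by (simp add: atomize_eq)
    qed auto
    have "P.prob {x \<in> space P. \<epsilon> \<le> \<bar>avg x n - measure \<mu> S\<bar>} \<le> 2 * exp (- 2 * real n * \<epsilon>\<^sup>2)"
      using H.Hoeffding_ineq_abs_ge'[of \<epsilon>] that by (auto simp: avg_def)
    also have "\<dots> = 2 * exp (- 2 * \<epsilon>\<^sup>2) ^ n"
      by (simp add: exp_of_nat_mult[symmetric] mult_ac)
    finally show ?thesis .
  qed
  have "AE x in P. \<forall>\<^sub>F n in sequentially. \<bar>avg x n - measure \<mu> S\<bar> < \<epsilon>" if "0 < \<epsilon>" for \<epsilon>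
  proof -
    define A where "A n = {x \<in> space P. \<epsilon> \<le> \<bar>avg x n - measure \<mu> S\<bar>}" for n
    have "summable (\<lambda>n. 2 * exp (- 2 * \<epsilon>\<^sup>2) ^ n)"
      using that by (intro summable_mult summable_geometric) auto
    \<comment> \<open>The tail bound needs \<open>n > 0\<close>, hence a comparison for all \<open>n \<ge> 1\<close> only.\<close>
    then have "summable (\<lambda>n. P.prob (A n))"
      by (rule summable_comparison_test_ev[rotated])
         (use tail[OF that] in \<open>auto simp: A_def eventually_sequentially intro!: exI[of _ 1]\<close>)
    then have "AE x in P. \<forall>\<^sub>F n in sequentially. x \<in> space P - A n"
      by (intro borel_cantelli_AE1) (auto simp: A_def P.emeasure_eq_measure)
    then show ?thesis
      by eventually_elim (auto elim!: eventually_mono simp: A_def)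
  qed
  then have "AE x in P. \<forall>k. \<forall>\<^sub>F n in sequentially. \<bar>avg x n - measure \<mu> S\<bar> < 1 / real (Suc k)"
    by (simp add: AE_all_countable)
  then have "AE x in P. avg x \<longlonglongrightarrow> measure \<mu> S"
  proof eventually_elim
    fix x assume *: "\<forall>k. \<forall>\<^sub>F n in sequentially. \<bar>avg x n - measure \<mu> S\<bar> < 1 / real (Suc k)"
    show "avg x \<longlonglongrightarrow> measure \<mu> S"
    proof (rule tendstoI)
      fix e :: real assume "0 < e"
      then obtain k where "1 / real (Suc k) < e"
        by (metis nat_approx_posE)
      then show "\<forall>\<^sub>F n in sequentially. dist (avg x n) (measure \<mu> S) < e"
        using *[rule_format, of k] by (auto elim!: eventually_mono simp: dist_real_def)
    qed
  qed
  then show ?thesis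
    unfolding P_def avg_def[abs_def] .
qed

section \<open>Densities and averages over shrinking windows\<close>

lemma prob_space_pos_cont_density:
  assumes "pos_cont_density f"
  shows "prob_space (density lborel (\<lambda>t. ennreal (f t)))"
proof
  have [measurable]: "f \<in> borel_measurable borel"
    using assms by (intro borel_measurable_continuous_onI) (simp add: pos_cont_density_def)
  show "emeasure (density lborel (\<lambda>t. ennreal (f t))) (space (density lborel (\<lambda>t. ennreal (f t)))) = 1"
    using assms by (simp add: emeasure_density pos_cont_density_def)
qed

text \<open>On a window so small that \<open>f\<close> stays within \<open>e / 2\<close> of \<open>f a\<close>, comparing \<open>f\<close> with the constants
  \<open>f a - e / 2\<close> and \<open>f a + e / 2\<close> traps the mass of the window between these constants times its
  length \<open>2 * h m\<close>.\<close>

lemma window_average_tendsto: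
  fixes f :: "real \<Rightarrow> real"
  assumes cont: "continuous_on UNIV f" and nonneg: "\<And>t. 0 \<le> f t"
    and prob: "prob_space (density lborel (\<lambda>t. ennreal (f t)))"
    and h_pos: "\<And>m. 0 < h m" and h_lim: "h \<longlonglongrightarrow> 0"
  shows "(\<lambda>m. measure (density lborel (\<lambda>t. ennreal (f t))) {a - h m..a + h m} / (2 * h m)) \<longlonglongrightarrow> f a"
proof (rule tendstoI)
  fix e :: real assume "0 < e"
  define \<mu> where "\<mu> = density lborel (\<lambda>t. ennreal (f t))"
  interpret prob_space \<mu> using prob by (simp add: \<mu>_def)
  have [measurable]: "f \<in> borel_measurable borel"
    by (intro borel_measurable_continuous_onI cont)
  obtain d where "0 < d" and d: "\<And>t. dist t a < d \<Longrightarrow> dist (f t) (f a) < e / 2"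
    using cont \<open>0 < e\<close> unfolding continuous_on_iff by (metis UNIV_I half_gt_zero)
  have "\<forall>\<^sub>F m in sequentially. h m < d"
    using order_tendstoD(2)[OF h_lim \<open>0 < d\<close>] .
  then show "\<forall>\<^sub>F m in sequentially.
      dist (measure (density lborel (\<lambda>t. ennreal (f t))) {a - h m..a + h m} / (2 * h m)) (f a) < e"
  proof eventually_elim
    fix m assume "h m < d"
    define W where "W = {a - h m..a + h m}"
    have [measurable]: "W \<in> sets borel" by (simp add: W_def)
    have osc: "f t \<le> f a + e / 2" "f a - e / 2 \<le> f t" if "t \<in> W" for t
    proof -
      have "\<bar>t - a\<bar> < d"
        using that \<open>h m < d\<close> unfolding W_def atLeastAtMost_iff by linarith
      then have "\<bar>f t - f a\<bar> < e / 2"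
        using d[of t] by (simp add: dist_real_def)
      then show "f t \<le> f a + e / 2" "f a - e / 2 \<le> f t" by linarith+
    qed
    have const: "(\<integral>\<^sup>+t. ennreal c * indicator W t \<partial>lborel) = ennreal (c * (2 * h m))" if "0 \<le> c" for c
      using that h_pos[of m] by (simp add: nn_integral_cmult_indicator W_def ennreal_mult)
    have mass: "ennreal (measure \<mu> W) = (\<integral>\<^sup>+t. ennreal (f t) * indicator W t \<partial>lborel)"
      unfolding emeasure_eq_measure[symmetric] by (simp add: \<mu>_def emeasure_density)
    have "ennreal (measure \<mu> W) \<le> (\<integral>\<^sup>+t. ennreal (f a + e / 2) * indicator W t \<partial>lborel)"
      unfolding mass
      by (intro nn_integral_mono) (auto split: split_indicator intro!: ennreal_leI osc)
    then have "measure \<mu> W \<le> (f a + e / 2) * (2 * h m)"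
      using const[of "f a + e / 2"] nonneg[of a] \<open>0 < e\<close> h_pos[of m] by simp
    \<comment> \<open>The integral below takes extended nonnegative values, so a negative lower constant has to be
      treated apart.\<close>
    moreover have "(f a - e / 2) * (2 * h m) \<le> measure \<mu> W"
    proof (cases "0 \<le> f a - e / 2")
      case True
      have "(\<integral>\<^sup>+t. ennreal (f a - e / 2) * indicator W t \<partial>lborel) \<le> ennreal (measure \<mu> W)"
        unfolding mass
        by (intro nn_integral_mono) (auto split: split_indicator intro!: ennreal_leI osc)
      then show ?thesis
        using const[OF True] by simp
    next
      case False
      then have "(f a - e / 2) * (2 * h m) \<le> 0"
        using h_pos[of m] by (intro mult_nonpos_nonneg) auto
      then show ?thesis using measure_nonneg[of \<mu> W] by linarith
    qed
    ultimately have "\<bar>measure \<mu> W / (2 * h m) - f a\<bar> \<le> e / 2"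
      using h_pos[of m] by (auto simp: abs_le_iff field_simps)
    then show "dist (measure (density lborel (\<lambda>t. ennreal (f t))) {a - h m..a + h m} / (2 * h m)) (f a) < e"
      using \<open>0 < e\<close> by (simp add: dist_real_def W_def \<mu>_def)
  qed
qed

section \<open>Counting distinct sample values\<close>

text \<open>Each distinct value in \<open>S\<close> is counted at the index where it first occurs. This makes the
  cardinality of the image a sum over indices, which is what its measurability rests on.\<close>

lemma card_image_Int_eq_sum_first_occurrences:
  fixes x :: "nat \<Rightarrow> 'a"
  shows "real (card (x ` {..<n} \<inter> S)) = (\<Sum>i<n. if x i \<in> S \<and> x i \<notin> x ` {..<i} then 1 else 0)"
proof (induction n)
  case (Suc n)
  have split: "x ` {..<Suc n} \<inter> S = (if x n \<in> S then insert (x n) (x ` {..<n} \<inter> S) else x ` {..<n} \<inter> S)"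
    by (auto simp: lessThan_Suc)
  show ?case
    using Suc by (simp add: split card_insert_if)
qed simp

lemma card_image_Int_eq_sum_indicator:
  fixes x :: "nat \<Rightarrow> 'a"
  assumes "inj x"
  shows "real (card (x ` {..<n} \<inter> S)) = (\<Sum>i<n. indicator S (x i))"
proof -
  have "(if x i \<in> S \<and> x i \<notin> x ` {..<i} then 1 else 0) = indicat_real S (x i)" for i
    using inj_eq[OF assms] by (auto simp: indicator_def)
  then show ?thesis
    by (simp only: card_image_Int_eq_sum_first_occurrences)
qed

section \<open>Measurability of the estimate\<close>

text \<open>The Borel sets of the product topology on \<open>nat \<Rightarrow> real\<close> form the product \<open>\<sigma>\<close>-algebra, in which
  the coordinates are measurable; the count is a function of finitely many coordinates.\<close>

lemma measurable_window_ratio: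
  "(\<lambda>x. window_ratio xs h x m n) \<in> borel_measurable borel"
proof -
  let ?B = "Pi\<^sub>M UNIV (\<lambda>_. borel) :: (nat \<Rightarrow> real) measure"
  have "Measurable.pred ?B (\<lambda>x. x i \<noteq> x j)" for i j
    unfolding pred_def by (rule borel_measurable_neq) simp_all
  then have "Measurable.pred ?B (\<lambda>x. \<forall>j\<in>{..<i}. x i \<noteq> x j)" for i
    by (intro pred_intros_finite(3)) simp_all
  moreover have "(\<lambda>x. \<forall>j\<in>{..<i}. x i \<noteq> x j) = (\<lambda>x :: nat \<Rightarrow> real. x i \<notin> x ` {..<i})" for i
    by (intro ext) (auto simp: image_iff)
  ultimately have new: "Measurable.pred ?B (\<lambda>x. x i \<notin> x ` {..<i})" for i
    by (simp only:)
  have "Measurable.pred ?B (\<lambda>x. x i \<in> {xs - h m..xs + h m})" for i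
    by measurable
  then have "Measurable.pred ?B (\<lambda>x. x i \<in> {xs - h m..xs + h m} \<and> x i \<notin> x ` {..<i})" for i
    using new by (rule pred_intros_logic(3))
  then have "(\<lambda>x. window_ratio xs h x m n) \<in> borel_measurable ?B"
    unfolding window_ratio_def card_image_Int_eq_sum_first_occurrences pred_def
    by (intro borel_measurable_divide borel_measurable_sum borel_measurable_const measurable_If)
  then show ?thesis
    unfolding measurable_cong_sets[OF sets_PiM_equal_borel refl] .
qed

lemma measurable_repeated_limit:
  assumes "\<And>m n. (\<lambda>x. a x m n) \<in> borel_measurable M"
  shows "(\<lambda>x. repeated_limit (a x)) \<in> borel_measurable M"
  unfolding repeated_limit_def
  by (intro borel_measurable_lim_metric assms)

lemma pred_repeated_limit_exists:
  assumes "\<And>m n. (\<lambda>x. a x m n) \<in> borel_measurable M"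
  shows "Measurable.pred M (\<lambda>x. repeated_limit_exists (a x))"
proof -
  \<comment> \<open>Convergence is the Cauchy property, which involves countably many conditions.\<close>
  have convergent: "Measurable.pred M (\<lambda>x. convergent (\<lambda>n. b x n))"
    if "\<And>n. (\<lambda>x. b x n) \<in> borel_measurable M" for b :: "_ \<Rightarrow> nat \<Rightarrow> real"
    using sets_Collect_Cauchy[of "\<lambda>n x. b x n" M] that
    unfolding pred_def Cauchy_convergent_iff .
  show ?thesis
    unfolding repeated_limit_exists_def
    by (intro pred_intros_logic pred_intros_countable convergent borel_measurable_lim_metric assms)
qed

lemma measurable_T_est:
  assumes "param_set \<A> xs \<in> sets borel"
  shows "T_est \<A> xs h \<theta>0 \<in> borel_measurable borel"
proof -
  have lim: "(\<lambda>x. repeated_limit (window_ratio xs h x)) \<in> borel_measurable borel"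
    by (intro measurable_repeated_limit measurable_window_ratio)
  have "param_set \<A> xs - {\<theta>0} \<in> sets borel"
    using assms by simp
  then have "Measurable.pred borel (\<lambda>x. repeated_limit (window_ratio xs h x) \<in> param_set \<A> xs - {\<theta>0})"
    by (rule pred_sets2[OF _ lim])
  with pred_repeated_limit_exists[of "window_ratio xs h", OF measurable_window_ratio]
  have "Measurable.pred borel (\<lambda>x. repeated_limit_exists (window_ratio xs h x) \<and>
      repeated_limit (window_ratio xs h x) \<in> param_set \<A> xs - {\<theta>0})"
    by (rule pred_intros_logic(3))
  then show ?thesis
    unfolding T_est_def[abs_def] pred_def
    by (intro measurable_If lim borel_measurable_const)
qed

section \<open>Consistency\<close>

lemma repeated_limit_eqI:
  assumes inner: "\<And>m. a m \<longlonglongrightarrow> b m" and outer: "b \<longlonglongrightarrow> l"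
  shows "repeated_limit_exists a" and "repeated_limit a = l"
proof -
  have "lim (a m) = b m" for m
    by (rule limI[OF inner])
  then show "repeated_limit_exists a" and "repeated_limit a = l"
    using inner outer
    by (auto simp: repeated_limit_exists_def repeated_limit_def convergent_def intro: limI)
qed

text \<open>The values at \<open>xs\<close> separate the densities, so the definite description in \<open>param_density\<close>
  denotes the density with value \<open>\<theta>\<close> at \<open>xs\<close>.\<close>

lemma param_density_characterization:
  assumes "\<And>g1 g2. g1 \<in> \<A> \<Longrightarrow> g2 \<in> \<A> \<Longrightarrow> g1 \<noteq> g2 \<Longrightarrow> g1 xs \<noteq> g2 xs"
    and "\<theta> \<in> param_set \<A> xs"
  shows "param_density \<A> xs \<theta> \<in> \<A>" and "param_density \<A> xs \<theta> xs = \<theta>"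
proof -
  have "\<exists>!f. f \<in> \<A> \<and> f xs = \<theta>"
    using assms unfolding param_set_def by blast
  from theI'[OF this] show "param_density \<A> xs \<theta> \<in> \<A>" "param_density \<A> xs \<theta> xs = \<theta>"
    by (simp_all add: param_density_def)
qed

text \<open>Distinctness of the sample turns window ratios into relative frequencies divided by \<open>2 * h m\<close>;
  the strong law gives the inner limits and continuity of \<open>f\<close> the outer one.\<close>

lemma repeated_limit_window_ratio_AE:
  fixes f :: "real \<Rightarrow> real"
  assumes f: "pos_cont_density f" and h_pos: "\<And>m. 0 < h m" and h_lim: "h \<longlonglongrightarrow> 0"
  shows "AE x in infinite_power (density lborel (\<lambda>t. ennreal (f t))).
           repeated_limit_exists (window_ratio xs h x) \<and>
           repeated_limit (window_ratio xs h x) = f xs"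
proof -
  define \<mu> where "\<mu> = density lborel (\<lambda>t. ennreal (f t))"
  have cont: "continuous_on UNIV f" and pos: "\<And>t. 0 < f t"
    using f by (auto simp: pos_cont_density_def)
  have [measurable]: "f \<in> borel_measurable borel"
    by (intro borel_measurable_continuous_onI cont)
  have prob: "prob_space \<mu>"
    unfolding \<mu>_def by (rule prob_space_pos_cont_density[OF f])
  have sets: "sets \<mu> = sets borel"
    by (simp add: \<mu>_def)
  have no_atoms: "AE t in \<mu>. t \<noteq> a" for a
    unfolding \<mu>_def by (subst AE_density) (use AE_lborel_singleton[of a] in auto)
  define W where "W m = {xs - h m..xs + h m}" for m
  have "AE x in infinite_power \<mu>.
          \<forall>m. (\<lambda>n. (\<Sum>i<n. indicat_real (W m) (x i)) / real n) \<longlonglongrightarrow> measure \<mu> (W m)"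
    unfolding infinite_power_def AE_all_countable
    by (intro allI relative_frequency_tendsto_AE prob) (simp add: sets W_def)
  moreover have "AE x in infinite_power \<mu>. inj x"
    unfolding infinite_power_def by (rule AE_inj_sample[OF prob sets no_atoms])
  ultimately show ?thesis
    unfolding \<mu>_def[symmetric]
  proof eventually_elim
    fix x
    assume freq: "\<forall>m. (\<lambda>n. (\<Sum>i<n. indicat_real (W m) (x i)) / real n) \<longlonglongrightarrow> measure \<mu> (W m)"
      and "inj x"
    have "window_ratio xs h x m = (\<lambda>n. (\<Sum>i<n. indicat_real (W m) (x i)) / real n / (2 * h m))" for m
      using \<open>inj x\<close>
      by (auto simp: fun_eq_iff window_ratio_def card_image_Int_eq_sum_indicator W_def mult_ac)
    then have inner: "window_ratio xs h x m \<longlonglongrightarrow> measure \<mu> (W m) / (2 * h m)" for m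
      using tendsto_divide[OF freq[rule_format, of m] tendsto_const[of "2 * h m"]] h_pos[of m] by simp
    have outer: "(\<lambda>m. measure \<mu> (W m) / (2 * h m)) \<longlonglongrightarrow> f xs"
      using window_average_tendsto[OF cont less_imp_le[OF pos] prob[unfolded \<mu>_def] h_pos h_lim]
      by (simp add: \<mu>_def W_def)
    show "repeated_limit_exists (window_ratio xs h x) \<and> repeated_limit (window_ratio xs h x) = f xs"
      using repeated_limit_eqI[OF inner outer] by simp
  qed
qed

theorem theorem5p3:
  fixes \<A> :: "(real \<Rightarrow> real) set" and xs :: real and h :: "nat \<Rightarrow> real" and \<theta>0 :: real
  assumes "\<And>g. g \<in> \<A> \<Longrightarrow> pos_cont_density g"
    and "\<And>g1 g2. g1 \<in> \<A> \<Longrightarrow> g2 \<in> \<A> \<Longrightarrow> g1 \<noteq> g2 \<Longrightarrow> g1 xs \<noteq> g2 xs"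
    and "\<And>m. 0 < h m"
    and "strict_antimono_on UNIV h"
    and "h \<longlonglongrightarrow> 0"
    and "\<theta>0 \<in> param_set \<A> xs"
  shows "(param_set \<A> xs \<in> sets borel \<longrightarrow>
            infinite_sample_consistent_estimate (param_set \<A> xs) (param_measure \<A> xs)
              (T_est \<A> xs h \<theta>0))
       \<and> (\<forall>\<theta>\<in>param_set \<A> xs.
            AE x in infinite_power (param_measure \<A> xs \<theta>). T_est \<A> xs h \<theta>0 x = \<theta>)"
proof -
  let ?\<Theta> = "param_set \<A> xs" and ?T = "T_est \<A> xs h \<theta>0"
  have consistent: "AE x in infinite_power (param_measure \<A> xs \<theta>). ?T x = \<theta>" if "\<theta> \<in> ?\<Theta>" for \<theta>
  proof -
    have f: "param_density \<A> xs \<theta> \<in> \<A>" "param_density \<A> xs \<theta> xs = \<theta>"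
      using param_density_characterization[of \<A> xs \<theta>] assms(2) that by blast+
    from repeated_limit_window_ratio_AE[OF assms(1)[OF f(1)] assms(3,5), of xs]
    show ?thesis
      unfolding param_measure_def
      \<comment> \<open>For \<open>\<theta> = \<theta>0\<close> the limit is excluded from the first branch, and the default value is \<open>\<theta>\<close>.\<close>
      by eventually_elim (use f(2) that in \<open>auto simp: T_est_def\<close>)
  qed
  have "infinite_sample_consistent_estimate ?\<Theta> (param_measure \<A> xs) ?T"
    if borel: "?\<Theta> \<in> sets borel"
    unfolding infinite_sample_consistent_estimate_def
  proof (intro conjI ballI)
    have T: "?T \<in> borel_measurable borel"
      by (rule measurable_T_est[OF borel])
    \<comment> \<open>The target algebra lives on \<open>?\<Theta>\<close>, and \<open>\<theta>0 \<in> ?\<Theta>\<close> covers the default value.\<close>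
    have "?T x \<in> ?\<Theta>" for x
      using assms(6) by (auto simp: T_est_def)
    then show "?T \<in> measurable borel (singleton_algebra ?\<Theta>)"
      unfolding singleton_algebra_def
      by (intro measurable_measure_of) (use measurable_sets[OF T] in auto)
    fix \<theta> assume \<theta>: "\<theta> \<in> ?\<Theta>"
    have "prob_space (param_measure \<A> xs \<theta>)"
      unfolding param_measure_def using assms(1,2) \<theta>
      by (intro prob_space_pos_cont_density assms(1) param_density_characterization(1)) auto
    then interpret P: prob_space "infinite_power (param_measure \<A> xs \<theta>)"
      unfolding infinite_power_def by (intro prob_space_PiM)
    have "sets (infinite_power (param_measure \<A> xs \<theta>)) = sets (Pi\<^sub>M UNIV (\<lambda>_. borel :: real measure))"
      unfolding infinite_power_def by (intro sets_PiM_cong) (simp_all add: param_measure_def)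
    then have sets: "sets (infinite_power (param_measure \<A> xs \<theta>)) = sets borel"
      by (simp add: sets_PiM_equal_borel)
    have "{x. ?T x = \<theta>} \<in> sets (infinite_power (param_measure \<A> xs \<theta>))"
      using measurable_sets[OF T, of "{\<theta>}"] by (simp add: sets vimage_def)
    then show "emeasure (infinite_power (param_measure \<A> xs \<theta>)) {x. ?T x = \<theta>} = 1"
      using consistent[OF \<theta>] by (intro P.emeasure_eq_1_AE) auto
  qed
  with consistent show ?thesis by blast
qed

end
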